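(* Let $R$ and $S$ be arbitrary commutative rings with nonzero identity and let $n\ge 1$ be an integer. Then there is a graph isomorphism $\overline{TD}(R\times S,n)\simeq \overline{TD}(R,n)\otimes \overline{TD}(S,n)$.
   Context: For a commutative ring $R$ and an integer $n\ge 1$, $\overline{TD}(R,n)$ is the graph (with loops allowed) whose vertex set is $R^n$ and in which $\mathbf{x}$ is adjacent to $\mathbf{y}$ (possibly $\mathbf{x}=\mathbf{y}$) if and only if $\mathbf{x}\cdot\mathbf{y}=0$, where $\mathbf{x}\cdot\mathbf{y}=\sum_{i=1}^n x_iy_i$ is the dot product; in particular a vertex $\mathbf{x}$ carries a loop if and only if $\mathbf{x}\cdot\mathbf{x}=0$. The tensor product $G_1\otimes G_2$ of graphs $G_1,G_2$ has vertex set $V(G_1)\times V(G_2)$, with $(u,v)$ adjacent to $(u',v')$ if and only if $u$ is adjacent to $u'$ in $G_1$ and $v$ is adjacent to $v'$ in $G_2$. *)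

theory Defs
  imports
    "HOL-Algebra.Chinese_Remainder"
    "Graph_Theory.Pair_Digraph"
    "Graph_Theory.Digraph_Isomorphism"
begin

text \<open>
  An undirected graph with loops is represented by its set of vertices together with its
  symmetric adjacency relation; a loop at \<open>x\<close> is the pair \<open>(x, x)\<close>.
\<close>

definition ring_vectors :: "('a, 'm) ring_scheme \<Rightarrow> nat \<Rightarrow> (nat \<Rightarrow> 'a) set" where
  "ring_vectors R n = {1..n} \<rightarrow>\<^sub>E carrier R"

definition ring_dot ::
    "('a, 'm) ring_scheme \<Rightarrow> nat \<Rightarrow> (nat \<Rightarrow> 'a) \<Rightarrow> (nat \<Rightarrow> 'a) \<Rightarrow> 'a" where
  "ring_dot R n x y = (\<Oplus>\<^bsub>R\<^esub>i\<in>{1..n}. x i \<otimes>\<^bsub>R\<^esub> y i)"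

definition total_dot_graph ::
    "('a, 'm) ring_scheme \<Rightarrow> nat \<Rightarrow> (nat \<Rightarrow> 'a) pair_pre_digraph" where
  "total_dot_graph R n =
     \<lparr>pverts = ring_vectors R n,
      parcs = {(x, y). x \<in> ring_vectors R n \<and> y \<in> ring_vectors R n \<and>
                       ring_dot R n x y = \<zero>\<^bsub>R\<^esub>}\<rparr>"

definition tensor_graph ::
    "'a pair_pre_digraph \<Rightarrow> 'b pair_pre_digraph \<Rightarrow> ('a \<times> 'b) pair_pre_digraph" where
  "tensor_graph G H =
     \<lparr>pverts = pverts G \<times> pverts H,
      parcs = {((u, v), (u', v')) | u v u' v'. (u, u') \<in> parcs G \<and> (v, v') \<in> parcs H}\<rparr>"

lemma total_dot_graph_wf: "pair_wf_digraph (total_dot_graph R n)"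
  by unfold_locales (auto simp: total_dot_graph_def)

lemma (in cring) ring_dot_commute:
  assumes "x \<in> ring_vectors R n" "y \<in> ring_vectors R n"
  shows "ring_dot R n x y = ring_dot R n y x"
  unfolding ring_dot_def using assms
  by (intro add.finprod_cong') (auto simp: ring_vectors_def PiE_iff m_comm)

lemma (in cring) total_dot_graph_sym: "sym (parcs (total_dot_graph R n))"
  by (auto simp: sym_def total_dot_graph_def ring_dot_commute)

lemma tensor_graph_wf:
  assumes "pair_wf_digraph G" "pair_wf_digraph H"
  shows "pair_wf_digraph (tensor_graph G H)"
  using assms by (auto simp: pair_wf_digraph_def tensor_graph_def)

lemma tensor_graph_sym:
  assumes "sym (parcs G)" "sym (parcs H)"
  shows "sym (parcs (tensor_graph G H))"
  using assms by (auto simp: sym_def tensor_graph_def)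

text \<open>
  On graphs without parallel arcs, \<^const>\<open>digraph_iso\<close> is the existence of a bijection of the
  vertices that preserves and reflects adjacency.
\<close>

lemma digraph_iso_pair_iff:
  assumes G: "pair_wf_digraph G" and H: "pair_wf_digraph H"
  shows "digraph_iso (with_proj G) (with_proj H) \<longleftrightarrow>
    (\<exists>f. bij_betw f (pverts G) (pverts H) \<and>
      (\<forall>x\<in>pverts G. \<forall>y\<in>pverts G. (x, y) \<in> parcs G \<longleftrightarrow> (f x, f y) \<in> parcs H))"
proof
  assume "digraph_iso (with_proj G) (with_proj H)"
  then obtain h where h: "pre_digraph.digraph_isomorphism (with_proj G) h"
    and eq: "with_proj H = app_iso h (with_proj G)"
    by (auto simp: digraph_iso_def)
  define f where "f = iso_verts h"
  have tl: "iso_tail h = fst" and hd: "iso_head h = snd"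
    and v: "pverts H = f ` pverts G" and a: "parcs H = iso_arcs h ` parcs G"
    using arg_cong[OF eq, of tail] arg_cong[OF eq, of head]
      arg_cong[OF eq, of verts] arg_cong[OF eq, of arcs] by (simp_all add: f_def)
  have inj: "inj_on f (pverts G)"
    using h by (simp add: pre_digraph.digraph_isomorphism_def f_def)
  have ia: "iso_arcs h e = (f (fst e), f (snd e))" if "e \<in> parcs G" for e
    using h that tl hd by (simp add: pre_digraph.digraph_isomorphism_def f_def prod_eq_iff)
  have "(x, y) \<in> parcs G \<longleftrightarrow> (f x, f y) \<in> parcs H" if "x \<in> pverts G" "y \<in> pverts G" for x y
  proof
    assume "(x, y) \<in> parcs G"
    then show "(f x, f y) \<in> parcs H" using ia[of "(x, y)"] a by force
  next
    assume "(f x, f y) \<in> parcs H"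
    then obtain e where e: "e \<in> parcs G" "f (fst e) = f x" "f (snd e) = f y"
      using a ia by auto
    have "fst e \<in> pverts G" "snd e \<in> pverts G"
      using e(1) pair_wf_digraph.arc_fst_in_verts[OF G] pair_wf_digraph.arc_snd_in_verts[OF G]
      by blast+
    then have "fst e = x" "snd e = y"
      using inj_onD[OF inj e(2)] inj_onD[OF inj e(3)] that by blast+
    with e show "(x, y) \<in> parcs G" by auto
  qed
  with inj v show "\<exists>f. bij_betw f (pverts G) (pverts H) \<and>
      (\<forall>x\<in>pverts G. \<forall>y\<in>pverts G. (x, y) \<in> parcs G \<longleftrightarrow> (f x, f y) \<in> parcs H)"
    by (auto simp: bij_betw_def)
next
  assume "\<exists>f. bij_betw f (pverts G) (pverts H) \<and>
      (\<forall>x\<in>pverts G. \<forall>y\<in>pverts G. (x, y) \<in> parcs G \<longleftrightarrow> (f x, f y) \<in> parcs H)"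
  then obtain f where f: "bij_betw f (pverts G) (pverts H)"
    and adj: "\<And>x y. x \<in> pverts G \<Longrightarrow> y \<in> pverts G \<Longrightarrow> (x, y) \<in> parcs G \<longleftrightarrow> (f x, f y) \<in> parcs H"
    by blast
  have inj: "inj_on f (pverts G)" and im: "f ` pverts G = pverts H"
    using f by (auto simp: bij_betw_def)
  have inG: "x \<in> pverts G" "y \<in> pverts G" if "(x, y) \<in> parcs G" for x y
    using pair_wf_digraph.in_arcsD1[OF G that] pair_wf_digraph.in_arcsD2[OF G that] by auto
  have arcs: "parcs H = map_prod f f ` parcs G"
  proof (intro Set.set_eqI iffI)
    fix e assume e: "e \<in> parcs H"
    then have "fst e \<in> f ` pverts G" "snd e \<in> f ` pverts G"
      using im pair_wf_digraph.arc_fst_in_verts[OF H] pair_wf_digraph.arc_snd_in_verts[OF H]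
      by auto
    then obtain x y where xy: "x \<in> pverts G" "y \<in> pverts G" "e = (f x, f y)"
      by (metis imageE prod.collapse)
    then have "(x, y) \<in> parcs G" using adj e by simp
    then show "e \<in> map_prod f f ` parcs G" using xy by force
  next
    fix e assume "e \<in> map_prod f f ` parcs G"
    then obtain x y where xy: "(x, y) \<in> parcs G" "e = (f x, f y)" by auto
    then show "e \<in> parcs H" using adj[OF inG[OF xy(1)]] by simp
  qed
  have inj2: "inj_on (map_prod f f) (parcs G)"
    by (rule inj_on_subset[OF map_prod_inj_on[OF inj inj]]) (use inG in auto)
  have wf: "wf_digraph (with_proj G)"
    using G by (simp add: wf_digraph_def pair_wf_digraph_def)
  let ?h = "\<lparr>iso_verts = f, iso_arcs = map_prod f f, iso_head = snd, iso_tail = fst\<rparr>"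
  have "pre_digraph.digraph_isomorphism (with_proj G) ?h"
    using wf inj inj2 by (auto simp: pre_digraph.digraph_isomorphism_def)
  moreover have "with_proj H = app_iso ?h (with_proj G)"
    using im arcs by (simp add: app_iso_def with_proj_def)
  ultimately show "digraph_iso (with_proj G) (with_proj H)"
    unfolding digraph_iso_def by blast
qed

end

theory Submission
  imports Defs
begin

text \<open>
  Both operations of \<open>R \<times> S\<close> act componentwise, so its two projections are ring homomorphisms, and
  a ring homomorphism applied to the entries of two vectors carries their dot product along. Hence
  the dot product of two vectors over \<open>R \<times> S\<close> is the pair formed by the dot product of their first
  components and the dot product of their second components, and it vanishes exactly when both of
  these vanish. The right-hand condition is adjacency in the tensor product. The
  isomorphism is therefore the bijection \<open>(R \<times> S)\<^sup>n \<rightarrow> R\<^sup>n \<times> S\<^sup>n\<close> that splits a vector of pairs into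
  the pair of its component vectors.
\<close>

lemma RDirProd_simps:
  "\<zero>\<^bsub>RDirProd R S\<^esub> = (\<zero>\<^bsub>R\<^esub>, \<zero>\<^bsub>S\<^esub>)"
  "\<one>\<^bsub>RDirProd R S\<^esub> = (\<one>\<^bsub>R\<^esub>, \<one>\<^bsub>S\<^esub>)"
  "p \<oplus>\<^bsub>RDirProd R S\<^esub> q = (fst p \<oplus>\<^bsub>R\<^esub> fst q, snd p \<oplus>\<^bsub>S\<^esub> snd q)"
  "p \<otimes>\<^bsub>RDirProd R S\<^esub> q = (fst p \<otimes>\<^bsub>R\<^esub> fst q, snd p \<otimes>\<^bsub>S\<^esub> snd q)"
  by (simp_all add: RDirProd_def DirProd_def monoid.defs case_prod_unfold)

lemma RDirProd_cring:
  assumes "cring R" and "cring S"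
  shows "cring (RDirProd R S)"
proof -
  interpret R: cring R by fact
  interpret S: cring S by fact
  interpret ring "RDirProd R S"
    by (rule RDirProd_ring) unfold_locales
  show ?thesis
    by unfold_locales (auto simp: RDirProd_simps RDirProd_carrier R.m_comm S.m_comm)
qed

lemma fst_ring_hom_RDirProd: "fst \<in> ring_hom (RDirProd R S) R"
  by (auto simp: ring_hom_def RDirProd_simps RDirProd_carrier)

lemma snd_ring_hom_RDirProd: "snd \<in> ring_hom (RDirProd R S) S"
  by (auto simp: ring_hom_def RDirProd_simps RDirProd_carrier)

lemma (in ring_hom_cring) hom_ring_dot:
  assumes "x \<in> ring_vectors R n" and "y \<in> ring_vectors R n"
  shows "h (ring_dot R n x y) = ring_dot S n (restrict (h \<circ> x) {1..n}) (restrict (h \<circ> y) {1..n})"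
proof -
  have cl: "x i \<in> carrier R" "y i \<in> carrier R" if "i \<in> {1..n}" for i
    using assms that by (auto simp: ring_vectors_def)
  have "h (ring_dot R n x y) = (\<Oplus>\<^bsub>S\<^esub>i\<in>{1..n}. (h \<circ> (\<lambda>i. x i \<otimes> y i)) i)"
    unfolding ring_dot_def using cl by (intro hom_finsum) auto
  also have "\<dots> = ring_dot S n (restrict (h \<circ> x) {1..n}) (restrict (h \<circ> y) {1..n})"
    unfolding ring_dot_def using cl by (intro S.finsum_cong') auto
  finally show ?thesis .
qed

text \<open>
  Vectors are extensional functions on \<open>{1..n}\<close>, so each component has to be restricted again
  to be a vector over its own ring.
\<close>

definition unzip_vector :: "nat \<Rightarrow> (nat \<Rightarrow> 'a \<times> 'b) \<Rightarrow> (nat \<Rightarrow> 'a) \<times> (nat \<Rightarrow> 'b)" where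
  "unzip_vector n x = (restrict (fst \<circ> x) {1..n}, restrict (snd \<circ> x) {1..n})"

lemma bij_betw_unzip_vector:
  "bij_betw (unzip_vector n) (ring_vectors (RDirProd R S) n) (ring_vectors R n \<times> ring_vectors S n)"
proof (rule bij_betw_byWitness[where f' = "\<lambda>(u, v). \<lambda>i\<in>{1..n}. (u i, v i)"])
  show "\<forall>x\<in>ring_vectors (RDirProd R S) n.
      (\<lambda>(u, v). \<lambda>i\<in>{1..n}. (u i, v i)) (unzip_vector n x) = x"
    by (auto simp: unzip_vector_def ring_vectors_def PiE_iff extensional_def fun_eq_iff)
  show "\<forall>p\<in>ring_vectors R n \<times> ring_vectors S n.
      unzip_vector n ((\<lambda>(u, v). \<lambda>i\<in>{1..n}. (u i, v i)) p) = p"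
    by (auto simp: unzip_vector_def ring_vectors_def PiE_iff extensional_def fun_eq_iff)
  show "unzip_vector n ` ring_vectors (RDirProd R S) n \<subseteq> ring_vectors R n \<times> ring_vectors S n"
    by (fastforce simp: unzip_vector_def ring_vectors_def RDirProd_carrier PiE_iff)
  show "(\<lambda>(u, v). \<lambda>i\<in>{1..n}. (u i, v i)) ` (ring_vectors R n \<times> ring_vectors S n)
      \<subseteq> ring_vectors (RDirProd R S) n"
    by (auto simp: ring_vectors_def RDirProd_carrier PiE_iff)
qed

text \<open>
  The two components of the dot product are its images under the projections, which are
  ring homomorphisms.
\<close>

lemma ring_dot_RDirProd:
  assumes "cring R" and "cring S"
    and x: "x \<in> ring_vectors (RDirProd R S) n" and y: "y \<in> ring_vectors (RDirProd R S) n"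
  shows "ring_dot (RDirProd R S) n x y =
    (ring_dot R n (fst (unzip_vector n x)) (fst (unzip_vector n y)),
     ring_dot S n (snd (unzip_vector n x)) (snd (unzip_vector n y)))"
proof -
  interpret R: cring R by fact
  interpret S: cring S by fact
  interpret RS: cring "RDirProd R S"
    using assms(1,2) by (rule RDirProd_cring)
  interpret proj1: ring_hom_cring "RDirProd R S" R fst
    by unfold_locales (rule fst_ring_hom_RDirProd)
  interpret proj2: ring_hom_cring "RDirProd R S" S snd
    by unfold_locales (rule snd_ring_hom_RDirProd)
  show ?thesis
    using proj1.hom_ring_dot[OF x y] proj2.hom_ring_dot[OF x y]
    by (simp add: prod_eq_iff unzip_vector_def)
qed

theorem theorem2p1:
  fixes R :: "('a, 'm) ring_scheme" and S :: "('b, 'k) ring_scheme" and n :: nat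
  assumes "cring R" and "\<one>\<^bsub>R\<^esub> \<noteq> \<zero>\<^bsub>R\<^esub>"
    and "cring S" and "\<one>\<^bsub>S\<^esub> \<noteq> \<zero>\<^bsub>S\<^esub>"
    and "n \<ge> 1"
  shows "digraph_iso (with_proj (total_dot_graph (RDirProd R S) n))
           (with_proj (tensor_graph (total_dot_graph R n) (total_dot_graph S n)))"
proof -
  let ?G = "total_dot_graph (RDirProd R S) n"
  let ?H = "tensor_graph (total_dot_graph R n) (total_dot_graph S n)"
  have bij: "bij_betw (unzip_vector n) (pverts ?G) (pverts ?H)"
    using bij_betw_unzip_vector by (simp add: total_dot_graph_def tensor_graph_def)
  have adj: "(x, y) \<in> parcs ?G \<longleftrightarrow> (unzip_vector n x, unzip_vector n y) \<in> parcs ?H"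
    if "x \<in> pverts ?G" and "y \<in> pverts ?G" for x y
  proof -
    have x: "x \<in> ring_vectors (RDirProd R S) n" and y: "y \<in> ring_vectors (RDirProd R S) n"
      using that by (simp_all add: total_dot_graph_def)
    obtain u v where u: "unzip_vector n x = (u, v)" "u \<in> ring_vectors R n" "v \<in> ring_vectors S n"
      using bij_betwE[OF bij_betw_unzip_vector] x by blast
    obtain u' v' where v: "unzip_vector n y = (u', v')"
        "u' \<in> ring_vectors R n" "v' \<in> ring_vectors S n"
      using bij_betwE[OF bij_betw_unzip_vector] y by blast
    show ?thesis
      using ring_dot_RDirProd[OF assms(1,3) x y] x y u v
      by (simp add: total_dot_graph_def tensor_graph_def RDirProd_simps)
  qed
  show ?thesis
    unfolding digraph_iso_pair_iff[OF total_dot_graph_wf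
        tensor_graph_wf[OF total_dot_graph_wf total_dot_graph_wf]]
    using bij adj by blast
qed

end
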